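(* The inequality $\Phi_{n-k}(P)\geq 2^n\binom{n}{k}$ fails in general for admissible polytopes, and it also fails, in a different dimension, for a linear section of a cube. That is: there exist integers $0\leq k\leq n$ with $n\geq 1$ and an admissible $n$-dimensional polytope $P\subset\mathbb{R}^n$ such that $$\Phi_{n-k}(P)<2^n\binom{n}{k};$$ and there exist integers $0\leq k'\leq n'\leq N$ with $n'\geq 1$, $n'\neq n$, and an $n'$-dimensional linear subspace $L\subset\mathbb{R}^N$ such that the polytope $P'=[-1,1]^N\cap L$ satisfies $$\Phi_{n'-k'}(P')<2^{n'}\binom{n'}{k'}.$$
   Context: A polytope means a compact convex polyhedron. An $n$-dimensional convex polytope $P\subset\mathbb{R}^n$ is called admissible if $0\in\operatorname{int}P$ and, for every $k\in\{1,\ldots,n\}$, every nonempty proper face $F$ of $P$ of codimension $k$ (i.e. $\dim F=n-k$) satisfies $\operatorname{dist}(0,\operatorname{aff}F)\geq\sqrt{k}$, where $\operatorname{aff}F$ is the affine hull of $F$. For an $n$-dimensional polytope $P$ and $0\leq j\leq n$, let $\mathcal{F}_j(P)$ be the set of $j$-dimensional faces of $P$ (with $\mathcal{F}_n(P)=\{P\}$) and define the total $j$-face measure $\Phi_j(P)=\sum_{F\in\mathcal{F}_j(P)}\mathcal{H}^j(F)$, where $\mathcal{H}^j$ is $j$-dimensional Hausdorff measure (Euclidean $j$-volume in the affine hull of $F$; $\mathcal{H}^0$ is counting measure). *)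

theory Defs
  imports "HOL-Analysis.Analysis"
begin

section \<open>Euclidean spaces of variable dimension\<close>

text \<open>
  The dimensions below are bound by quantifiers and compared with one another, so they cannot be
  type parameters as in \<^typ>\<open>real ^ 'n\<close>.  Instead \<open>R\<^sup>n\<close> is the coordinate subspace
  \<open>Rn n\<close> of the inner product space of finitely supported real sequences, with the standard inner
  product, so that the library notions for inner product spaces apply to it. The type of finitely
  supported functions in \<open>HOL-Library.Poly_Mapping\<close> is not used, because
  \<open>HOL-Analysis.Finite_Function_Topology\<close> equips it with the \<open>l\<^sup>1\<close> norm.
\<close>

typedef finseq = "{f :: nat \<Rightarrow> real. finite {i. f i \<noteq> 0}}"
  morphisms coord Abs_finseq
  by (rule exI [of _ "\<lambda>_. 0"]) simp

lemma finite_support [simp]: "finite {i. coord x i \<noteq> 0}"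
  using coord [of x] by simp

lemma coord_Abs [simp]: "finite {i. f i \<noteq> 0} \<Longrightarrow> coord (Abs_finseq f) = f"
  by (simp add: Abs_finseq_inverse)

lemma finseq_eqI: "(\<And>i. coord x i = coord y i) \<Longrightarrow> x = y"
  by (metis coord_inject ext)

instantiation finseq :: real_vector
begin

definition zero_finseq :: finseq where
  "0 = Abs_finseq (\<lambda>_. 0)"

definition plus_finseq :: "finseq \<Rightarrow> finseq \<Rightarrow> finseq" where
  "x + y = Abs_finseq (\<lambda>i. coord x i + coord y i)"

definition minus_finseq :: "finseq \<Rightarrow> finseq \<Rightarrow> finseq" where
  "x - y = Abs_finseq (\<lambda>i. coord x i - coord y i)"

definition uminus_finseq :: "finseq \<Rightarrow> finseq" where
  "- x = Abs_finseq (\<lambda>i. - coord x i)"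

definition scaleR_finseq :: "real \<Rightarrow> finseq \<Rightarrow> finseq" where
  "c *\<^sub>R x = Abs_finseq (\<lambda>i. c * coord x i)"

lemma coord_zero [simp]: "coord 0 i = 0"
  by (simp add: zero_finseq_def)

lemma coord_add [simp]: "coord (x + y) i = coord x i + coord y i"
proof -
  have "finite {i. coord x i + coord y i \<noteq> 0}"
    by (rule finite_subset [of _ "{i. coord x i \<noteq> 0} \<union> {i. coord y i \<noteq> 0}"]) auto
  then show ?thesis
    by (simp add: plus_finseq_def)
qed

lemma coord_diff [simp]: "coord (x - y) i = coord x i - coord y i"
proof -
  have "finite {i. coord x i - coord y i \<noteq> 0}"
    by (rule finite_subset [of _ "{i. coord x i \<noteq> 0} \<union> {i. coord y i \<noteq> 0}"]) auto
  then show ?thesis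
    by (simp add: minus_finseq_def)
qed

lemma coord_uminus [simp]: "coord (- x) i = - coord x i"
  by (simp add: uminus_finseq_def)

lemma coord_scaleR [simp]: "coord (c *\<^sub>R x) i = c * coord x i"
proof -
  have "finite {i. c * coord x i \<noteq> 0}"
    by (rule finite_subset [of _ "{i. coord x i \<noteq> 0}"]) auto
  then show ?thesis
    by (simp add: scaleR_finseq_def)
qed

instance
proof
  fix x y z :: finseq and c d :: real
  show "x + y + z = x + (y + z)" "x + y = y + x" "0 + x = x" "- x + x = 0" "x - y = x + - y"
    by (auto intro!: finseq_eqI)
  show "c *\<^sub>R (x + y) = c *\<^sub>R x + c *\<^sub>R y" "(c + d) *\<^sub>R x = c *\<^sub>R x + d *\<^sub>R x"
    "c *\<^sub>R d *\<^sub>R x = (c * d) *\<^sub>R x" "1 *\<^sub>R x = x"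
    by (auto intro!: finseq_eqI simp: algebra_simps)
qed

end

instantiation finseq :: real_inner
begin

definition inner_finseq :: "finseq \<Rightarrow> finseq \<Rightarrow> real" where
  "inner x y = (\<Sum>i | coord x i \<noteq> 0 \<and> coord y i \<noteq> 0. coord x i * coord y i)"

definition norm_finseq :: "finseq \<Rightarrow> real" where
  "norm_finseq x = sqrt (inner x x)"

definition sgn_finseq :: "finseq \<Rightarrow> finseq" where
  "sgn_finseq x = x /\<^sub>R norm x"

definition dist_finseq :: "finseq \<Rightarrow> finseq \<Rightarrow> real" where
  "dist_finseq x y = norm (x - y)"

definition uniformity_finseq :: "(finseq \<times> finseq) filter" where
  "uniformity_finseq = (INF e\<in>{0<..}. principal {(x, y :: finseq). dist x y < e})"

definition open_finseq :: "finseq set \<Rightarrow> bool" where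
  "open_finseq U \<longleftrightarrow> (\<forall>x\<in>U. \<forall>\<^sub>F (x', y) in uniformity. x' = x \<longrightarrow> y \<in> U)"

lemma inner_finseq_superset:
  assumes "finite A" and "{i. coord x i \<noteq> 0 \<and> coord y i \<noteq> 0} \<subseteq> A"
  shows "inner x y = (\<Sum>i\<in>A. coord x i * coord y i)"
  unfolding inner_finseq_def using assms by (intro sum.mono_neutral_left) auto

instance
proof
  fix x y z :: finseq and c :: real
  let ?A = "{i. coord x i \<noteq> 0} \<union> {i. coord y i \<noteq> 0}"
  have A: "finite ?A" by simp
  show "sgn x = x /\<^sub>R norm x" "dist x y = norm (x - y)" "norm x = sqrt (inner x x)"
    by (simp_all add: sgn_finseq_def dist_finseq_def norm_finseq_def)
  show "uniformity = (INF e\<in>{0<..}. principal {(x, y :: finseq). dist x y < e})"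
    by (simp add: uniformity_finseq_def)
  show "open U \<longleftrightarrow> (\<forall>x\<in>U. \<forall>\<^sub>F (x', y) in uniformity. x' = x \<longrightarrow> y \<in> U)" for U :: "finseq set"
    by (simp add: open_finseq_def)
  show "inner x y = inner y x"
    by (simp add: inner_finseq_def conj_commute mult.commute)
  have "inner (x + y) z = (\<Sum>i\<in>?A. coord (x + y) i * coord z i)"
    by (rule inner_finseq_superset [OF A]) auto
  also have "\<dots> = (\<Sum>i\<in>?A. coord x i * coord z i) + (\<Sum>i\<in>?A. coord y i * coord z i)"
    by (simp add: distrib_right sum.distrib)
  also have "(\<Sum>i\<in>?A. coord x i * coord z i) = inner x z"
    by (rule inner_finseq_superset [OF A, symmetric]) auto
  also have "(\<Sum>i\<in>?A. coord y i * coord z i) = inner y z"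
    by (rule inner_finseq_superset [OF A, symmetric]) auto
  finally show "inner (x + y) z = inner x z + inner y z" .
  have "inner (c *\<^sub>R x) y = (\<Sum>i\<in>?A. coord (c *\<^sub>R x) i * coord y i)"
    by (rule inner_finseq_superset [OF A]) auto
  also have "\<dots> = c * (\<Sum>i\<in>?A. coord x i * coord y i)"
    by (simp add: sum_distrib_left mult.assoc)
  also have "(\<Sum>i\<in>?A. coord x i * coord y i) = inner x y"
    by (rule inner_finseq_superset [OF A, symmetric]) auto
  finally show "inner (c *\<^sub>R x) y = c * inner x y" .
  show "0 \<le> inner x x"
    by (auto simp: inner_finseq_def intro: sum_nonneg)
  show "inner x x = 0 \<longleftrightarrow> x = 0"
    by (auto simp: inner_finseq_def sum_nonneg_eq_0_iff intro: finseq_eqI)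
qed

end

definition Rn :: "nat \<Rightarrow> finseq set" where
  "Rn n = {x. \<forall>i\<ge>n. coord x i = 0}"

lemma inner_Rn:
  assumes "x \<in> Rn n"
  shows "inner x y = (\<Sum>i<n. coord x i * coord y i)"
  using assms by (intro inner_finseq_superset) (auto simp: Rn_def not_less [symmetric])

lemma norm_Rn:
  assumes "x \<in> Rn n"
  shows "norm x = sqrt (\<Sum>i<n. (coord x i)\<^sup>2)"
  using inner_Rn [OF assms] by (simp add: norm_eq_sqrt_inner power2_eq_square)

definition cube :: "nat \<Rightarrow> finseq set" where
  "cube N = {x \<in> Rn N. \<forall>i<N. coord x i \<in> {-1..1}}"


section \<open>Affine dimension\<close>

text \<open>
  The library's \<^const>\<open>aff_dim\<close> is restricted to \<^class>\<open>euclidean_space\<close>.  The dimension of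
  \<open>aff S\<close> is that of its direction space, which is spanned by the differences of points of \<open>S\<close>.
  Only meaningful for nonempty \<open>S\<close> with finite-dimensional affine hull.
\<close>

definition adim :: "'a::real_vector set \<Rightarrow> nat" where
  "adim S = dim {x - y | x y. x \<in> S \<and> y \<in> S}"

lemma adim_eq_aff_dim:
  fixes S :: "'a::euclidean_space set"
  assumes "S \<noteq> {}"
  shows "int (adim S) = aff_dim S"
proof -
  obtain a where a: "a \<in> S" using assms by blast
  let ?T = "(\<lambda>x. x - a) ` S"
  let ?D = "{x - y | x y. x \<in> S \<and> y \<in> S}"
  have "x - y \<in> span ?T" if "x \<in> S" "y \<in> S" for x y
  proof -
    have "(x - a) - (y - a) \<in> span ?T"
      using that by (intro span_diff span_base) auto
    then show ?thesis by simp
  qed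
  then have "?D \<subseteq> span ?T" by auto
  moreover have "?T \<subseteq> ?D" using a by auto
  ultimately have "span ?T = span ?D"
    by (simp add: span_eq span_superset subset_trans)
  then have "dim ?T = dim ?D"
    by (rule span_eq_dim)
  moreover have "aff_dim S = int (dim ?T)"
    using aff_dim_eq_dim_subtract [of a S] a by (simp add: hull_inc)
  ultimately show ?thesis by (simp add: adim_def)
qed


section \<open>Hausdorff measure\<close>

text \<open>
  The \<open>j\<close>-dimensional Hausdorff (outer) measure for integral \<open>j\<close>, in the normalization under which
  it agrees with Lebesgue measure on \<open>j\<close>-dimensional affine subspaces and is counting measure for
  \<open>j = 0\<close>.  In \<open>hausdorff_gauge\<close>, \<open>0 ^ 0 = 1\<close>, so for \<open>j = 0\<close> every nonempty set has gauge 1; the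
  empty set has gauge 0 for every \<open>j\<close>. Boundedness is required in the coverings because
  \<^const>\<open>diameter\<close> is unspecified on unbounded sets.
\<close>

definition hausdorff_gauge :: "nat \<Rightarrow> 'a::metric_space set \<Rightarrow> ennreal" where
  "hausdorff_gauge j U =
     (if U = {} then 0 else ennreal (unit_ball_vol (real j) * (diameter U / 2) ^ j))"

definition hausdorff_pre :: "nat \<Rightarrow> real \<Rightarrow> 'a::metric_space set \<Rightarrow> ennreal" where
  "hausdorff_pre j \<delta> A =
     (INF U \<in> {U :: nat \<Rightarrow> 'a set. A \<subseteq> (\<Union>i. U i) \<and> (\<forall>i. bounded (U i) \<and> diameter (U i) \<le> \<delta>)}.
        \<Sum>i. hausdorff_gauge j (U i))"

definition hausdorff_measure :: "nat \<Rightarrow> 'a::metric_space set \<Rightarrow> ennreal" where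
  "hausdorff_measure j A = (SUP \<delta> \<in> {0<..}. hausdorff_pre j \<delta> A)"


section \<open>Faces and admissible polytopes\<close>

definition faces :: "nat \<Rightarrow> 'a::real_vector set \<Rightarrow> 'a set set" where
  "faces j P = {F. F face_of P \<and> F \<noteq> {} \<and> adim F = j}"

text \<open>A polytope has finitely many faces, so the sum below is never over an infinite set.\<close>

definition face_measure :: "nat \<Rightarrow> 'a::real_inner set \<Rightarrow> ennreal" where
  "face_measure j P = (\<Sum>F \<in> faces j P. hausdorff_measure j F)"

definition admissible :: "nat \<Rightarrow> finseq set \<Rightarrow> bool" where
  "admissible n P \<longleftrightarrow>
     polytope P \<and> P \<subseteq> Rn n \<and> P \<noteq> {} \<and> adim P = n \<and>
     0 \<in> top_of_set (Rn n) interior_of P \<and>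
     (\<forall>k \<in> {1..n}. \<forall>F. F face_of P \<and> F \<noteq> {} \<and> F \<noteq> P \<and> adim F = n - k \<longrightarrow>
        infdist 0 (affine hull F) \<ge> sqrt (real k))"

end

theory Submission
  imports Defs
begin

text \<open>
  Both inequalities already fail for \<open>j = n - k = 0\<close>, where \<open>\<Phi>\<^sub>0\<close> is the number of vertices and the
  conjectured bound is \<open>2\<^sup>n\<close>.

  Admissibility bounds distances from the origin only from below, so it does not force many
  vertices: a simplex that is large enough is admissible and has only \<open>n + 1\<close> of them. In the plane,
  a triangle whose sides have distance at least \<open>1\<close> and whose vertices have distance at least
  \<open>sqrt 2\<close> from the origin has \<open>3 < 4\<close> vertices. The triangle used below is cut out by
  \<open>x\<^sub>0 \<ge> -1\<close>, \<open>x\<^sub>1 \<ge> -1\<close> and \<open>x\<^sub>0 + x\<^sub>1 \<le> 2\<close>; its lower left corner is \<open>(-1, -1)\<close>, at distance exactly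
  \<open>sqrt 2\<close>. A proper face misses the interior, and being convex it then lies on one of the three side
  lines (\<open>proper_face_of_triangle\<close>); this gives the bound for \<open>k = 1\<close>.

  A central section of a cube is centrally symmetric, which excludes simplices, but a
  three-dimensional section of \<open>[-1, 1]\<^sup>4\<close> can be an octahedron, with \<open>6 < 8\<close> vertices. It is the
  section by the hyperplane \<open>\<Sum>x\<^sub>i = 0\<close>. In any even dimension \<open>2 m\<close> the vertices of that section are
  sign vectors with as many entries \<open>1\<close> as \<open>-1\<close>: an extreme point has at most one coordinate strictly
  between \<open>-1\<close> and \<open>1\<close> (\<open>extreme_point_cube_section\<close>), and parity excludes even one. So there are at
  most \<open>(2 m) choose m\<close> of them.

  To bound \<open>\<Phi>\<^sub>0\<close> from above it suffices that a face of dimension \<open>0\<close> is a singleton extreme point and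
  that the zero-dimensional Hausdorff measure of a point is at most \<open>1\<close>
  (\<open>face_measure_0_le_card\<close>).
\<close>

section \<open>Coordinates and dimension\<close>

definition unit_seq :: "nat \<Rightarrow> finseq" where
  "unit_seq i = Abs_finseq (\<lambda>j. if j = i then 1 else 0)"

lemma coord_unit_seq [simp]: "coord (unit_seq i) j = (if j = i then 1 else 0)"
  by (simp add: unit_seq_def)

lemma coord_sum: "coord (\<Sum>i\<in>A. f i) j = (\<Sum>i\<in>A. coord (f i) j)"
  by (induction A rule: infinite_finite_induct) auto

lemma inner_unit_seq: "unit_seq i \<bullet> x = coord x i"
proof -
  have "unit_seq i \<bullet> x = (\<Sum>j\<in>{i}. coord (unit_seq i) j * coord x j)"
    by (rule inner_finseq_superset) auto
  then show ?thesis by simp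
qed

lemma continuous_on_coord [continuous_intros]: "continuous_on A (\<lambda>x. coord x i)"
  unfolding inner_unit_seq [symmetric] by (intro continuous_intros)

lemma subspace_Rn: "subspace (Rn n)"
  by (auto simp: subspace_def Rn_def)

lemma Rn_eq_span: "Rn n = span (unit_seq ` {..<n})"
proof
  show "span (unit_seq ` {..<n}) \<subseteq> Rn n"
    by (rule span_minimal [OF _ subspace_Rn]) (auto simp: Rn_def)
  show "Rn n \<subseteq> span (unit_seq ` {..<n})"
  proof
    fix x assume x: "x \<in> Rn n"
    have "x = (\<Sum>i<n. coord x i *\<^sub>R unit_seq i)"
      using x by (intro finseq_eqI) (auto simp: coord_sum Rn_def if_distrib cong: if_cong)
    moreover have "(\<Sum>i<n. coord x i *\<^sub>R unit_seq i) \<in> span (unit_seq ` {..<n})"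
      by (intro span_sum span_scale span_base) auto
    ultimately show "x \<in> span (unit_seq ` {..<n})" by simp
  qed
qed

text \<open>
  Vectors whose first \<open>m\<close> coordinates form an invertible diagonal matrix are independent, because a
  coordinate of a linear combination reads off the corresponding coefficient.
\<close>

lemma dim_of_diagonal_basis:
  assumes v: "\<And>i. i < m \<Longrightarrow> v i \<in> V"
    and diag: "\<And>i. i < m \<Longrightarrow> coord (v i) i \<noteq> 0"
    and off: "\<And>i j. i < m \<Longrightarrow> j < m \<Longrightarrow> i \<noteq> j \<Longrightarrow> coord (v i) j = 0"
    and span: "V \<subseteq> span (v ` {..<m})"
  shows "dim V = m"
proof -
  have inj: "inj_on v {..<m}"
    by (intro inj_onI, rule ccontr) (use diag off in fastforce)
  have "independent (v ` {..<m})"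
  proof (rule independent_if_scalars_zero)
    fix c w assume zero: "(\<Sum>w\<in>v ` {..<m}. c w *\<^sub>R w) = 0" and "w \<in> v ` {..<m}"
    then obtain j where j: "j < m" "w = v j" by auto
    have "0 = coord (\<Sum>i<m. c (v i) *\<^sub>R v i) j"
      using zero by (simp add: sum.reindex [OF inj])
    also have "\<dots> = (\<Sum>i<m. if i = j then c (v i) * coord (v i) j else 0)"
      unfolding coord_sum using off j by (intro sum.cong) auto
    also have "\<dots> = c w * coord (v j) j"
      using j by simp
    finally show "c w = 0"
      using diag j by simp
  qed simp
  then show ?thesis
    using v span by (intro dim_unique [of "v ` {..<m}"]) (auto simp: card_image inj)
qed


section \<open>Counting vertices\<close>

text \<open>One ball of radius \<open>0\<close> covers a point at every scale; all other covering sets can be empty.\<close>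

lemma hausdorff_measure_0_singleton_le: "hausdorff_measure 0 {x} \<le> 1"
proof -
  define U where "U i = (if i = (0::nat) then {x} else {})" for i
  have "(\<Sum>i. hausdorff_gauge 0 (U i)) = 1"
  proof -
    have "(\<Sum>i. hausdorff_gauge 0 (U i)) = (\<Sum>i\<in>{0}. hausdorff_gauge 0 (U i))"
      by (rule suminf_finite) (auto simp: U_def hausdorff_gauge_def)
    then show ?thesis by (simp add: U_def hausdorff_gauge_def)
  qed
  moreover have "hausdorff_pre 0 \<delta> {x} \<le> (\<Sum>i. hausdorff_gauge 0 (U i))" if "\<delta> > 0" for \<delta>
    unfolding hausdorff_pre_def using that by (intro INF_lower) (auto simp: U_def)
  ultimately show ?thesis
    unfolding hausdorff_measure_def by (intro SUP_least) auto
qed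

text \<open>
  Finite dimension of the ambient space matters: the dimension of an infinite-dimensional
  direction space would also be \<open>0\<close>, by the convention for infinite cardinalities.
\<close>

lemma adim_0_imp_singleton:
  assumes "adim F = 0" "F \<noteq> {}" "F \<subseteq> Rn n"
  obtains x where "F = {x}"
proof -
  let ?D = "{x - y | x y. x \<in> F \<and> y \<in> F}"
  obtain B where B: "B \<subseteq> ?D" "independent B" "?D \<subseteq> span B" "card B = dim ?D"
    by (rule basis_exists)
  have "?D \<subseteq> Rn n"
    using assms(3) subspace_diff [OF subspace_Rn] by blast
  then have "finite B"
    using B independent_span_bound [of "unit_seq ` {..<n}" B] by (auto simp: Rn_eq_span)
  then have "?D \<subseteq> {0}"
    using B assms(1) by (simp add: adim_def)
  then have D: "x - y = 0" if "x \<in> F" "y \<in> F" for x y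
    using that by blast
  have "x = y" if "x \<in> F" "y \<in> F" for x y
    using D [OF that] by simp
  then show thesis
    using assms(2) that by blast
qed

lemma face_measure_0_le_card:
  assumes "P \<subseteq> Rn n" "finite S" "{x. x extreme_point_of P} \<subseteq> S"
  shows "face_measure 0 P \<le> of_nat (card S)"
proof -
  have "faces 0 P \<subseteq> (\<lambda>x. {x}) ` S"
  proof
    fix F assume "F \<in> faces 0 P"
    then have F: "F face_of P" "F \<noteq> {}" "adim F = 0" by (auto simp: faces_def)
    then have "F \<subseteq> Rn n" using assms(1) face_of_imp_subset by blast
    then obtain x where "F = {x}" using F adim_0_imp_singleton by metis
    then show "F \<in> (\<lambda>x. {x}) ` S" using F assms(3) by (auto simp: face_of_singleton)
  qed
  then have "face_measure 0 P \<le> (\<Sum>F\<in>(\<lambda>x. {x}) ` S. hausdorff_measure 0 F)"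
    unfolding face_measure_def using assms(2) by (intro sum_mono2) auto
  also have "\<dots> \<le> (\<Sum>F\<in>(\<lambda>x. {x}) ` S. 1)"
    by (intro sum_mono) (auto simp: hausdorff_measure_0_singleton_le)
  also have "\<dots> = of_nat (card S)"
    by (simp add: card_image)
  finally show ?thesis .
qed


section \<open>The admissible triangle\<close>

text \<open>
  By the Cauchy-Schwarz inequality, the hyperplane \<open>u \<bullet> x = b\<close> has distance at least
  \<open>b / norm u\<close> from the origin.
\<close>

lemma infdist_affine_hull_ge_1:
  fixes u :: "'a::real_inner"
  assumes "F \<noteq> {}" and F: "\<And>x. x \<in> F \<Longrightarrow> u \<bullet> x = b" and b: "norm u \<le> b" "0 < b"
  shows "1 \<le> infdist 0 (affine hull F)"
proof -
  have sub: "affine hull F \<subseteq> {x. u \<bullet> x = b}"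
    using F by (intro hull_minimal) (auto simp: affine_hyperplane)
  have "1 \<le> dist 0 x" if "x \<in> affine hull F" for x
  proof -
    have "b \<le> norm u * norm x"
      using sub that norm_cauchy_schwarz [of u x] by auto
    also have "\<dots> \<le> b * norm x"
      using b by (simp add: mult_right_mono)
    finally show ?thesis
      using b by simp
  qed
  moreover have "affine hull F \<noteq> {}"
    using assms(1) by simp
  ultimately show ?thesis
    by (simp add: infdist_notempty cINF_greatest)
qed

definition plane_point :: "real \<Rightarrow> real \<Rightarrow> finseq" where
  "plane_point a b = a *\<^sub>R unit_seq 0 + b *\<^sub>R unit_seq 1"

lemma coord_plane_point [simp]:
  "coord (plane_point a b) i = (if i = 0 then a else if i = 1 then b else 0)"
  by (simp add: plane_point_def)

lemma plane_point_in_Rn [simp]: "plane_point a b \<in> Rn 2"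
  by (simp add: Rn_def)

lemma inner_plane_point: "plane_point a b \<bullet> x = a * coord x 0 + b * coord x 1"
  by (simp add: plane_point_def inner_add_left inner_unit_seq)

lemma norm_plane_point: "norm (plane_point a b) = sqrt (a\<^sup>2 + b\<^sup>2)"
  by (simp add: norm_eq_sqrt_inner inner_plane_point power2_eq_square)

lemma Rn_2_eqI: "x \<in> Rn 2 \<Longrightarrow> y \<in> Rn 2 \<Longrightarrow> coord x 0 = coord y 0 \<Longrightarrow> coord x 1 = coord y 1 \<Longrightarrow> x = y"
proof (rule finseq_eqI)
  fix i assume "x \<in> Rn 2" "y \<in> Rn 2" "coord x 0 = coord y 0" "coord x 1 = coord y 1"
  then show "coord x i = coord y i"
    by (cases "i = 0 \<or> i = 1") (auto simp: Rn_def)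
qed

definition triangle :: "finseq set" where
  "triangle = {x \<in> Rn 2. -1 \<le> coord x 0 \<and> -1 \<le> coord x 1 \<and> coord x 0 + coord x 1 \<le> 2}"

definition triangle_vertices :: "finseq set" where
  "triangle_vertices = {plane_point (-1) (-1), plane_point 3 (-1), plane_point (-1) 3}"

definition triangle_interior :: "finseq set" where
  "triangle_interior = {x. -1 < coord x 0 \<and> -1 < coord x 1 \<and> coord x 0 + coord x 1 < 2}"

lemma triangle_eq_hull: "triangle = convex hull triangle_vertices"
proof
  show "triangle \<subseteq> convex hull triangle_vertices"
  proof
    fix x assume x: "x \<in> triangle"
    \<comment> \<open>The barycentric coordinates of \<open>x\<close>: each is the slack in the inequality of the opposite
      side, divided by the slack \<open>4\<close> at the vertex.\<close>
    define \<alpha> \<beta> \<gamma> where "\<alpha> = (2 - coord x 0 - coord x 1) / 4" "\<beta> = (coord x 0 + 1) / 4"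
      "\<gamma> = (coord x 1 + 1) / 4"
    note defs = this
    have "x = \<alpha> *\<^sub>R plane_point (-1) (-1) + \<beta> *\<^sub>R plane_point 3 (-1) + \<gamma> *\<^sub>R plane_point (-1) 3"
      using x by (intro Rn_2_eqI) (auto simp: triangle_def defs field_simps Rn_def)
    moreover have "0 \<le> \<alpha>" "0 \<le> \<beta>" "0 \<le> \<gamma>" "\<alpha> + \<beta> + \<gamma> = 1"
      using x by (auto simp: triangle_def defs field_simps)
    ultimately show "x \<in> convex hull triangle_vertices"
      unfolding triangle_vertices_def convex_hull_3 by blast
  qed
  have "coord x 0 \<ge> -1 \<and> coord x 1 \<ge> -1 \<and> coord x 0 + coord x 1 \<le> 2 \<and> x \<in> Rn 2"
    if "x \<in> convex hull triangle_vertices" for x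
  proof -
    from that obtain a b c where abc: "0 \<le> a" "0 \<le> b" "0 \<le> c" "a + b + c = 1"
      and x: "x = a *\<^sub>R plane_point (-1) (-1) + b *\<^sub>R plane_point 3 (-1) + c *\<^sub>R plane_point (-1) 3"
      unfolding triangle_vertices_def convex_hull_3 by blast
    show ?thesis
      using abc by (auto simp: x Rn_def)
  qed
  then show "convex hull triangle_vertices \<subseteq> triangle"
    by (auto simp: triangle_def)
qed

lemma open_triangle_interior: "open triangle_interior"
  unfolding triangle_interior_def
  by (intro open_Collect_conj open_Collect_less continuous_intros)

lemma rel_interior_triangle: "triangle_interior \<inter> Rn 2 \<subseteq> rel_interior triangle"
proof
  fix x assume x: "x \<in> triangle_interior \<inter> Rn 2"
  have "affine hull triangle \<subseteq> Rn 2"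
    by (rule hull_minimal) (auto simp: triangle_def subspace_Rn subspace_imp_affine)
  then have "triangle_interior \<inter> affine hull triangle \<subseteq> triangle"
    by (auto simp: triangle_def triangle_interior_def)
  moreover have "x \<in> triangle_interior \<inter> triangle"
    using x by (auto simp: triangle_def triangle_interior_def)
  ultimately show "x \<in> rel_interior triangle"
    using open_triangle_interior by (auto simp: mem_rel_interior)
qed

text \<open>
  Otherwise the face contains, for each side, a point off the line of that side; a proper convex
  combination of the three points is off all three lines, hence a relative interior point of the
  triangle.
\<close>

lemma proper_face_of_triangle:
  assumes F: "F face_of triangle" "F \<noteq> triangle"
  shows "(\<forall>x\<in>F. coord x 0 = -1) \<or> (\<forall>x\<in>F. coord x 1 = -1) \<or> (\<forall>x\<in>F. coord x 0 + coord x 1 = 2)"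
proof (rule ccontr)
  assume "\<not> ?thesis"
  then obtain p q r where pqr: "p \<in> F" "q \<in> F" "r \<in> F"
    "coord p 0 \<noteq> -1" "coord q 1 \<noteq> -1" "coord r 0 + coord r 1 \<noteq> 2"
    by blast
  have sub: "F \<subseteq> triangle" and conv: "convex F"
    using F face_of_imp_subset face_of_imp_convex by auto
  define z where "z = (1/2) *\<^sub>R p + (1/2) *\<^sub>R ((1/2) *\<^sub>R q + (1/2) *\<^sub>R r)"
  have z: "z \<in> F"
    unfolding z_def using pqr by (intro convexD [OF conv]) auto
  have "p \<in> triangle" "q \<in> triangle" "r \<in> triangle" "z \<in> triangle"
    using pqr z sub by auto
  moreover from this have "-1 < coord p 0" "-1 < coord q 1" "coord r 0 + coord r 1 < 2"
    using pqr by (auto simp: triangle_def)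
  moreover have "coord z 0 = coord p 0 / 2 + coord q 0 / 4 + coord r 0 / 4"
      "coord z 1 = coord p 1 / 2 + coord q 1 / 4 + coord r 1 / 4"
    by (simp_all add: z_def)
  ultimately have "-1 < coord z 0 \<and> -1 < coord z 1 \<and> coord z 0 + coord z 1 < 2 \<and> z \<in> Rn 2"
    unfolding triangle_def mem_Collect_eq by (intro conjI; linarith)
  then have "z \<in> triangle_interior \<inter> Rn 2"
    by (simp add: triangle_interior_def)
  then have "z \<in> rel_interior triangle"
    using rel_interior_triangle by blast
  then show False
    using face_of_disjoint_rel_interior [OF F] z by blast
qed

lemma adim_triangle: "adim triangle = 2"
  unfolding adim_def
proof (rule dim_of_diagonal_basis)
  let ?D = "{x - y | x y. x \<in> triangle \<and> y \<in> triangle}"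
  define v where "v i = 4 *\<^sub>R unit_seq i" for i
  have "v 0 = plane_point 3 (-1) - plane_point (-1) (-1)"
       "v 1 = plane_point (-1) 3 - plane_point (-1) (-1)"
    by (auto intro!: finseq_eqI simp: v_def)
  moreover have "plane_point 3 (-1) \<in> triangle" "plane_point (-1) (-1) \<in> triangle"
    "plane_point (-1) 3 \<in> triangle"
    by (auto simp: triangle_def)
  ultimately have "v 0 \<in> ?D" "v 1 \<in> ?D"
    by blast+
  then show "v i \<in> ?D" if "i < 2" for i
    using that by (auto simp: less_2_cases_iff)
  show "coord (v i) i \<noteq> 0" for i
    by (simp add: v_def)
  show "coord (v i) j = 0" if "i \<noteq> j" for i j
    using that by (simp add: v_def)
  have "unit_seq i \<in> span (v ` {..<2})" if "i < 2" for i
  proof -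
    have "(1/4) *\<^sub>R v i \<in> span (v ` {..<2})"
      using that by (intro span_scale span_base) auto
    then show ?thesis by (simp add: v_def)
  qed
  then have "Rn 2 \<subseteq> span (v ` {..<2})"
    unfolding Rn_eq_span by (intro span_minimal) auto
  moreover have "?D \<subseteq> Rn 2"
    using subspace_diff [OF subspace_Rn] by (auto simp: triangle_def)
  ultimately show "?D \<subseteq> span (v ` {..<2})"
    by blast
qed

lemma admissible_triangle: "admissible 2 triangle"
proof -
  have poly: "polytope triangle"
    unfolding polytope_def triangle_eq_hull
    by (intro exI [of _ triangle_vertices]) (simp add: triangle_vertices_def)
  have "0 \<in> triangle_interior \<inter> Rn 2"
    by (simp add: triangle_interior_def Rn_def)
  moreover have "openin (top_of_set (Rn 2)) (triangle_interior \<inter> Rn 2)"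
    using open_triangle_interior by (metis Int_commute openin_open_Int)
  moreover have "triangle_interior \<inter> Rn 2 \<subseteq> triangle"
    by (auto simp: triangle_def triangle_interior_def)
  ultimately have inter: "0 \<in> top_of_set (Rn 2) interior_of triangle"
    unfolding interior_of_def by blast
  have "sqrt (real k) \<le> infdist 0 (affine hull F)"
    if k: "k \<in> {1..2}" and F: "F face_of triangle" "F \<noteq> {}" "F \<noteq> triangle" "adim F = 2 - k" for k F
  proof (cases "k = 1")
    case True
    have "1 \<le> infdist 0 (affine hull F)"
      using proper_face_of_triangle [OF F(1,3)]
    proof (elim disjE)
      assume "\<forall>x\<in>F. coord x 0 = -1"
      then show ?thesis
        by (intro infdist_affine_hull_ge_1 [OF F(2), of "plane_point (-1) 0" 1])
          (auto simp: inner_plane_point norm_plane_point)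
    next
      assume "\<forall>x\<in>F. coord x 1 = -1"
      then show ?thesis
        by (intro infdist_affine_hull_ge_1 [OF F(2), of "plane_point 0 (-1)" 1])
          (auto simp: inner_plane_point norm_plane_point)
    next
      assume "\<forall>x\<in>F. coord x 0 + coord x 1 = 2"
      then show ?thesis
        by (intro infdist_affine_hull_ge_1 [OF F(2), of "plane_point 1 1" 2])
          (auto simp: inner_plane_point norm_plane_point intro: real_le_lsqrt)
    qed
    then show ?thesis using True by simp
  next
    case False
    then have k: "k = 2" using k by auto
    have "F \<subseteq> Rn 2"
      using face_of_imp_subset [OF F(1)] by (auto simp: triangle_def)
    with F k obtain x where x: "F = {x}"
      using adim_0_imp_singleton by (metis diff_self_eq_0)
    then have "x \<in> triangle_vertices"
      using F(1) extreme_point_of_convex_hull by (simp add: face_of_singleton triangle_eq_hull)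
    then have "sqrt 2 \<le> norm x"
      by (auto simp: triangle_vertices_def norm_plane_point)
    moreover have "affine hull F = {x}"
      unfolding x by (rule hull_same) simp
    ultimately show ?thesis
      by (simp add: k)
  qed
  then show ?thesis
    unfolding admissible_def using poly inter adim_triangle
    by (auto simp: triangle_def interior_of_def)
qed

lemma face_measure_0_triangle: "face_measure 0 triangle \<le> of_nat 3"
proof -
  have "face_measure 0 triangle \<le> of_nat (card triangle_vertices)"
  proof (rule face_measure_0_le_card)
    show "triangle \<subseteq> Rn 2" by (auto simp: triangle_def)
    show "finite triangle_vertices" by (simp add: triangle_vertices_def)
    show "{x. x extreme_point_of triangle} \<subseteq> triangle_vertices"
      unfolding triangle_eq_hull by (rule extreme_points_of_convex_hull)
  qed
  moreover have "card triangle_vertices \<le> 3"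
    by (simp add: triangle_vertices_def card_insert_if)
  ultimately show ?thesis
    by (meson of_nat_mono order_trans)
qed


section \<open>The diagonal hyperplane section of the cube\<close>

definition zero_sum :: "nat \<Rightarrow> finseq set" where
  "zero_sum N = {x \<in> Rn N. (\<Sum>i<N. coord x i) = 0}"

lemma subspace_zero_sum: "subspace (zero_sum N)"
  by (auto simp: subspace_def zero_sum_def Rn_def sum.distrib simp flip: sum_distrib_left)

lemma dim_zero_sum: "dim (zero_sum (Suc m)) = m"
proof (rule dim_of_diagonal_basis)
  define v where "v i = unit_seq i - unit_seq m" for i
  show "v i \<in> zero_sum (Suc m)" if "i < m" for i
    using that by (auto simp: v_def zero_sum_def Rn_def sum_subtractf)
  show "coord (v i) i \<noteq> 0" if "i < m" for i
    using that by (simp add: v_def)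
  show "coord (v i) j = 0" if "j < m" "i \<noteq> j" for i j
    using that by (simp add: v_def)
  show "zero_sum (Suc m) \<subseteq> span (v ` {..<m})"
  proof
    fix x assume x: "x \<in> zero_sum (Suc m)"
    have "x = (\<Sum>i<m. coord x i *\<^sub>R v i)"
    proof (rule finseq_eqI)
      fix j
      consider "j < m" | "j = m" | "j > m" by linarith
      then show "coord x j = coord (\<Sum>i<m. coord x i *\<^sub>R v i) j"
      proof cases
        case 1
        then have "(\<Sum>i<m. coord x i * coord (v i) j) = (\<Sum>i<m. if i = j then coord x i else 0)"
          by (intro sum.cong) (auto simp: v_def)
        then show ?thesis using 1 by (simp add: coord_sum)
      next
        case 2
        then have "(\<Sum>i<m. coord x i * coord (v i) j) = (\<Sum>i<m. - coord x i)"
          by (intro sum.cong) (auto simp: v_def)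
        then show ?thesis using 2 x by (simp add: coord_sum zero_sum_def sum_negf)
      next
        case 3
        then show ?thesis using x by (simp add: coord_sum zero_sum_def Rn_def v_def)
      qed
    qed
    moreover have "(\<Sum>i<m. coord x i *\<^sub>R v i) \<in> span (v ` {..<m})"
      by (intro span_sum span_scale span_base) auto
    ultimately show "x \<in> span (v ` {..<m})" by simp
  qed
qed

text \<open>
  If two coordinates could both move, then moving one up and the other down by the same amount would
  keep the sum, and \<open>x\<close> would be the midpoint of two points of the section.
\<close>

lemma extreme_point_cube_section:
  assumes x: "x extreme_point_of (cube N \<inter> zero_sum N)" and ij: "i < N" "j < N" "i \<noteq> j"
  shows "\<bar>coord x i\<bar> = 1 \<or> \<bar>coord x j\<bar> = 1"
proof (rule ccontr)
  assume not: "\<not> ?thesis"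
  have xP: "x \<in> cube N" "x \<in> zero_sum N"
    using x by (auto simp: extreme_point_of_def)
  have le1: "\<bar>coord x k\<bar> \<le> 1" if "k < N" for k
    using xP that by (auto simp: cube_def abs_le_iff)
  define \<epsilon> where "\<epsilon> = min (1 - \<bar>coord x i\<bar>) (1 - \<bar>coord x j\<bar>)"
  have \<epsilon>: "0 < \<epsilon>" "\<bar>coord x i\<bar> + \<epsilon> \<le> 1" "\<bar>coord x j\<bar> + \<epsilon> \<le> 1"
    using not le1 [OF ij(1)] le1 [OF ij(2)] by (auto simp: \<epsilon>_def)
  define d where "d = \<epsilon> *\<^sub>R (unit_seq i - unit_seq j)"
  have "unit_seq i - unit_seq j \<in> zero_sum N"
    using ij by (auto simp: zero_sum_def Rn_def sum_subtractf)
  then have d_sum: "d \<in> zero_sum N"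
    unfolding d_def by (rule subspace_scale [OF subspace_zero_sum])
  have "x + s *\<^sub>R d \<in> cube N \<inter> zero_sum N" if s: "\<bar>s\<bar> = 1" for s
  proof -
    have sum: "x + s *\<^sub>R d \<in> zero_sum N"
      using xP d_sum subspace_zero_sum by (simp add: subspace_add subspace_scale)
    have "s = 1 \<or> s = -1"
      using s by linarith
    then have bound: "-1 \<le> coord (x + s *\<^sub>R d) k \<and> coord (x + s *\<^sub>R d) k \<le> 1" if "k < N" for k
    proof -
      have "coord d k = (if k = i then \<epsilon> else if k = j then - \<epsilon> else 0)"
        using ij by (simp add: d_def)
      then show ?thesis
        using \<open>s = 1 \<or> s = -1\<close> le1 [OF that] \<epsilon> by (auto split: if_splits)
    qed
    then show ?thesis
      using sum by (simp add: cube_def zero_sum_def)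
  qed
  from this [of 1] this [of "-1"]
  have mem: "x + d \<in> cube N \<inter> zero_sum N" "x - d \<in> cube N \<inter> zero_sum N"
    by auto
  have "coord d i = \<epsilon>"
    using ij by (simp add: d_def)
  then have "coord (x - d) i \<noteq> coord (x + d) i"
    using \<epsilon> by simp
  then have "x - d \<noteq> x + d"
    by metis
  moreover have "x = (1 - 1/2) *\<^sub>R (x - d) + (1/2) *\<^sub>R (x + d)"
    by (intro finseq_eqI) (simp add: field_simps)
  ultimately have "x \<in> open_segment (x - d) (x + d)"
    unfolding in_segment by (intro conjI exI [of _ "1/2"]) auto
  then show False
    using x mem by (auto simp: extreme_point_of_def)
qed

lemma sum_signs:
  fixes f :: "'b \<Rightarrow> real"
  assumes "finite A" "\<And>i. i \<in> A \<Longrightarrow> \<bar>f i\<bar> = 1"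
  shows "sum f A = 2 * real (card {i \<in> A. f i = 1}) - real (card A)"
proof -
  have "sum f A = (\<Sum>i\<in>A. 2 * (if f i = 1 then 1 else 0) - 1)"
  proof (rule sum.cong)
    fix i assume "i \<in> A"
    then have "f i = 1 \<or> f i = -1"
      using assms(2) [of i] by linarith
    then show "f i = 2 * (if f i = 1 then 1 else 0) - 1"
      by auto
  qed simp
  also have "\<dots> = 2 * (\<Sum>i\<in>A. if f i = 1 then 1 else 0) - real (card A)"
    by (simp add: sum_subtractf sum_distrib_left)
  also have "(\<Sum>i\<in>A. if f i = 1 then 1 else (0::real)) = real (card {i \<in> A. f i = 1})"
    using assms(1) by (simp add: sum.If_cases Int_def)
  finally show ?thesis .
qed

text \<open>
  If one coordinate were not a sign, it would be minus a sum of an odd number of signs, that is, an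
  odd integer strictly between \<open>-1\<close> and \<open>1\<close>.
\<close>

lemma extreme_point_even_cube_section:
  assumes x: "x extreme_point_of (cube (2 * m) \<inter> zero_sum (2 * m))" and i: "i < 2 * m"
  shows "\<bar>coord x i\<bar> = 1"
proof (rule ccontr)
  assume not: "\<bar>coord x i\<bar> \<noteq> 1"
  let ?A = "{..<2 * m} - {i}"
  define c where "c = card {j \<in> ?A. coord x j = 1}"
  have xP: "x \<in> cube (2 * m)" "x \<in> zero_sum (2 * m)"
    using x by (auto simp: extreme_point_of_def)
  have "\<bar>coord x j\<bar> = 1" if "j \<in> ?A" for j
    using extreme_point_cube_section [OF x i, of j] that not by auto
  then have "sum (coord x) ?A = 2 * real c - real (card ?A)"
    unfolding c_def by (intro sum_signs) auto
  moreover have "real (card ?A) = 2 * real m - 1"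
    using i by (simp add: of_nat_diff)
  moreover have "coord x i + sum (coord x) ?A = 0"
    using xP i sum.remove [of "{..<2 * m}" i "coord x"] by (simp add: zero_sum_def)
  moreover have "-1 \<le> coord x i" "coord x i \<le> 1"
    using xP(1) i by (auto simp: cube_def)
  then have "\<bar>coord x i\<bar> < 1"
    using not by linarith
  ultimately have "\<bar>of_int (2 * int c - 2 * int m + 1) :: real\<bar> < 1"
    by simp
  then have "\<bar>2 * int c - 2 * int m + 1\<bar> < 1"
    by linarith
  then show False
    by presburger
qed

lemma face_measure_0_cube_section:
  "face_measure 0 (cube (2 * m) \<inter> zero_sum (2 * m)) \<le> of_nat ((2 * m) choose m)"
proof -
  let ?P = "cube (2 * m) \<inter> zero_sum (2 * m)"
  define S where "S = {x. x extreme_point_of ?P}"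
  define plus where "plus x = {i \<in> {..<2 * m}. coord x i = 1}" for x
  let ?K = "{A. A \<subseteq> {..<2 * m} \<and> card A = m}"
  have sub: "?P \<subseteq> Rn (2 * m)"
    by (auto simp: cube_def)
  have sign: "\<bar>coord x i\<bar> = 1" if "x \<in> S" "i < 2 * m" for x i
    using that extreme_point_even_cube_section by (auto simp: S_def)
  have SP: "S \<subseteq> ?P"
    by (auto simp: S_def extreme_point_of_def)
  have inj: "inj_on plus S"
  proof (intro inj_onI finseq_eqI)
    fix x y i assume xy: "x \<in> S" "y \<in> S" "plus x = plus y"
    show "coord x i = coord y i"
    proof (cases "i < 2 * m")
      case True
      then have "coord x i = 1 \<longleftrightarrow> coord y i = 1"
        using xy(3) by (auto simp: plus_def set_eq_iff)
      then show ?thesis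
        using sign [OF xy(1) True] sign [OF xy(2) True] by linarith
    next
      case False
      then show ?thesis
        using xy SP sub by (auto simp: Rn_def subset_iff)
    qed
  qed
  have im: "plus ` S \<subseteq> ?K"
  proof clarify
    fix x assume x: "x \<in> S"
    then have "(\<Sum>i<2 * m. coord x i) = 0"
      using SP by (auto simp: zero_sum_def)
    moreover have "(\<Sum>i<2 * m. coord x i) = 2 * real (card (plus x)) - real (card {..<2 * m})"
      unfolding plus_def using sign [OF x] by (intro sum_signs) auto
    ultimately have "card (plus x) = m"
      by simp
    then show "plus x \<subseteq> {..<2 * m} \<and> card (plus x) = m"
      by (auto simp: plus_def)
  qed
  have finK: "finite ?K"
    by simp
  have "finite S"
    using inj_on_finite [OF inj im finK] .
  then have "face_measure 0 ?P \<le> of_nat (card S)"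
    using sub by (intro face_measure_0_le_card) (auto simp: S_def)
  moreover have "card S \<le> (2 * m) choose m"
    using card_inj_on_le [OF inj im finK] by (simp add: n_subsets)
  ultimately show ?thesis
    by (meson of_nat_mono order_trans)
qed

theorem proposition5p1:
  shows "\<exists>(n::nat) (k::nat) (P::finseq set).
           k \<le> n \<and> 1 \<le> n \<and> admissible n P \<and>
           face_measure (n - k) P < of_nat (2 ^ n * (n choose k)) \<and>
           (\<exists>(N::nat) (n'::nat) (k'::nat) (L::finseq set).
              k' \<le> n' \<and> n' \<le> N \<and> 1 \<le> n' \<and> n' \<noteq> n \<and>
              subspace L \<and> L \<subseteq> Rn N \<and> dim L = n' \<and>
              face_measure (n' - k') (cube N \<inter> L) < of_nat (2 ^ n' * (n' choose k')))"
proof -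
  have "face_measure 0 triangle < of_nat (2 ^ 2 * (2 choose 2))"
    by (rule le_less_trans [OF face_measure_0_triangle]) (unfold of_nat_less_iff, simp)
  moreover have "face_measure 0 (cube 4 \<inter> zero_sum 4) < of_nat (2 ^ 3 * (3 choose 3))"
  proof -
    have "(4::nat) choose 2 = 6"
      by (simp add: choose_two)
    then have "face_measure 0 (cube 4 \<inter> zero_sum 4) \<le> of_nat 6"
      using face_measure_0_cube_section [of 2] by (simp del: of_nat_numeral)
    also have "of_nat 6 < (of_nat (2 ^ 3 * (3 choose 3)) :: ennreal)"
      unfolding of_nat_less_iff by simp
    finally show ?thesis .
  qed
  moreover have "dim (zero_sum 4) = 3"
    using dim_zero_sum [of 3] by (simp add: numeral_eq_Suc)
  moreover have "zero_sum 4 \<subseteq> Rn 4"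
    by (auto simp: zero_sum_def)
  ultimately show ?thesis
    using admissible_triangle subspace_zero_sum
    by (intro exI [of _ 2] exI [of _ triangle] conjI exI [of _ 4] exI [of _ 3] exI [of _ "zero_sum 4"])
      auto
qed

end
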